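(* Let $w$ be a word over $\Sigma_n$. Then $w$ is a universal Lyndon word if and only if for every cyclic factor $u$ of $w$ one has $|w|^c_u=(n-|\mathrm{alp}(u)|)!$.
   Context: $\Sigma_n=\{1,\ldots,n\}$. For a word $w=a_1\cdots a_m$ its conjugates are $w_i=a_i\cdots a_m a_1\cdots a_{i-1}$ ($1\le i\le m$); a proper conjugate is $w_2w_1$ where $w=w_1w_2$ with $w_1,w_2$ nonempty. A total order on the alphabet induces the lexicographic order on words ($u$ is smaller than $v$ if $u$ is a proper prefix of $v$, or $u=zau'$, $v=zbv'$ with letters $a<b$). A word $w$ over $\Sigma_n$ is a Lyndon word if for some total order on $\Sigma_n$ it is strictly lexicographically smaller than each of its proper conjugates. A universal Lyndon word of degree $n$ is a word over $\Sigma_n$ of length $n!$ all of whose conjugates are Lyndon words. A cyclic factor of $w$ is a nonempty word $u$ with $|u|\le|w|$ that is a factor of $ww$; $|w|^c_u$ is the number of indices $i\in\{1,\ldots,|w|\}$ such that $u$ is a prefix of $w_i$. $\mathrm{alp}(u)$ is the set of letters occurring in $u$.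
   Formalization: The alphabet is nonempty (n ≥ 1), and the counting condition is supplemented by the requirement that every letter of Σ_n occurs in w; without it the converse fails, e.g. for n = 2 and w = 1, whose only cyclic factor has count 1 = (2−1)! although |w| ≠ 2!. *)

theory Defs
  imports "HOL-Library.Sublist"
begin

abbreviation Sigma_n :: "nat \<Rightarrow> nat set" where
  "Sigma_n n \<equiv> {1..n}"

definition proper_conjugates :: "'a list \<Rightarrow> 'a list set" where
  "proper_conjugates w = {w2 @ w1 | w1 w2. w = w1 @ w2 \<and> w1 \<noteq> [] \<and> w2 \<noteq> []}"

(* Library linear orders are reflexive, whereas lexord expects the strict order on letters,
   hence the removal of the diagonal. *)
definition lyndon :: "nat \<Rightarrow> nat list \<Rightarrow> bool" where
  "lyndon n w \<longleftrightarrow> set w \<subseteq> Sigma_n n \<and>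
     (\<exists>r. linear_order_on (Sigma_n n) r \<and>
          (\<forall>v \<in> proper_conjugates w. (w, v) \<in> lexord (r - Id)))"

(* The conjugate starting at the (i+1)-st letter of w is rotate i w. *)
definition universal_lyndon :: "nat \<Rightarrow> nat list \<Rightarrow> bool" where
  "universal_lyndon n w \<longleftrightarrow> set w \<subseteq> Sigma_n n \<and> length w = fact n \<and>
     (\<forall>i < length w. lyndon n (rotate i w))"

(* The empty word is not a cyclic factor, so prescribing cyclic_count for all cyclic factors
   does not determine the length of w: the one-letter word [1] satisfies the counting condition
   with n = 2 (more generally replicate (fact (n - 1)) a does for every letter a and n \<ge> 2, and
   the empty word for every n).  An equivalence with universal_lyndon therefore has to require
   in addition that every letter of Sigma_n n occurs in w. *)
definition cyclic_factor :: "'a list \<Rightarrow> 'a list \<Rightarrow> bool" where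
  "cyclic_factor u w \<longleftrightarrow> u \<noteq> [] \<and> length u \<le> length w \<and> sublist u (w @ w)"

definition cyclic_count :: "'a list \<Rightarrow> 'a list \<Rightarrow> nat" where
  "cyclic_count w u = card {i. i < length w \<and> prefix u (rotate i w)}"

end

theory Submission
  imports Defs "HOL-Combinatorics.Multiset_Permutations"
begin

text \<open>
  Conjugates that are minimal for the same order coincide, so a universal Lyndon word matches
  its \<open>n!\<close> positions bijectively with the \<open>n!\<close> orders of the alphabet.
  If a cyclic factor \<open>u\<close> can be continued by a letter \<open>c\<close> of \<open>u\<close>, then \<open>c\<close> is its only
  continuation: if \<open>u = x c t\<close> and \<open>d\<close> is another one, the conjugate starting with \<open>c t d\<close> has
  \<open>c\<close> as its least letter, yet \<open>c t c\<close> occurs too and would be smaller.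
  By induction on \<open>u\<close>, the conjugates with prefix \<open>u\<close> are those whose order starts with
  the letters of \<open>u\<close> in order of first occurrence.  The critical case is that \<open>c\<close> continues
  \<open>u\<close> and \<open>d\<close> does not, for some \<open>c, d\<close> not in \<open>u\<close>: two orders starting with the letters of
  \<open>u\<close> and differing only by swapping the adjacent \<open>c\<close> and \<open>d\<close> then give two
  conjugates with prefix \<open>u c\<close>, which can only branch at \<open>c\<close> against \<open>d\<close>, although \<open>c\<close>
  already occurs in the common prefix.

  Conversely, the counts show that a conjugate is Lyndon for the order of first occurrence
  of its letters: where two conjugates branch, neither of the two letters has occurred before.
\<close>

section \<open>Orders given by lists\<close>

text \<open>Linear orders of a finite alphabet are encoded as lists of its letters: orders can then
  be counted as permutations, and starting with given letters becomes a prefix condition. The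
  relation is strict, as \<open>lexord\<close> expects.\<close>

definition before :: "'a list \<Rightarrow> ('a \<times> 'a) set" where
  "before s = {(s ! p, s ! q) | p q. p < q \<and> q < length s}"

lemma beforeI: "p < q \<Longrightarrow> q < length s \<Longrightarrow> (s ! p, s ! q) \<in> before s"
  unfolding before_def by blast

lemma before_asym: "distinct s \<Longrightarrow> (x, y) \<in> before s \<Longrightarrow> (y, x) \<notin> before s"
  unfolding before_def by (auto simp: nth_eq_iff_index_eq)

lemma before_irrefl: "distinct s \<Longrightarrow> (x, x) \<notin> before s"
  using before_asym by metis

lemma before_trans:
  assumes "distinct s" "(x, y) \<in> before s" "(y, z) \<in> before s"
  shows "(x, z) \<in> before s"
proof -
  obtain p q where pq: "p < q" "q < length s" "x = s ! p" "y = s ! q"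
    using assms(2) unfolding before_def by auto
  obtain q' r where qr: "q' < r" "r < length s" "y = s ! q'" "z = s ! r"
    using assms(3) unfolding before_def by auto
  have "q = q'" using pq qr assms(1) by (simp add: nth_eq_iff_index_eq)
  then show ?thesis using beforeI[of p r s] pq qr by simp
qed

lemma before_total:
  "x \<in> set s \<Longrightarrow> y \<in> set s \<Longrightarrow> x \<noteq> y \<Longrightarrow> (x, y) \<in> before s \<or> (y, x) \<in> before s"
proof -
  assume "x \<in> set s" "y \<in> set s" "x \<noteq> y"
  then obtain p q where "p < length s" "q < length s" "x = s ! p" "y = s ! q" "p \<noteq> q"
    unfolding in_set_conv_nth by metis
  then show ?thesis unfolding before_def by (cases "p < q") auto
qed

lemma before_subset: "(x, y) \<in> before s \<Longrightarrow> x \<in> set s \<and> y \<in> set s"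
  unfolding before_def by auto

lemma before_append:
  "(x, y) \<in> before (s @ t) \<longleftrightarrow>
    (x, y) \<in> before s \<or> (x, y) \<in> before t \<or> x \<in> set s \<and> y \<in> set t"
proof
  assume "(x, y) \<in> before (s @ t)"
  then obtain p q where pq: "p < q" "q < length s + length t" "x = (s @ t) ! p" "y = (s @ t) ! q"
    unfolding before_def by auto
  consider "q < length s" | "p < length s" "length s \<le> q" | "length s \<le> p" by linarith
  then show "(x, y) \<in> before s \<or> (x, y) \<in> before t \<or> x \<in> set s \<and> y \<in> set t"
  proof cases
    case 1
    then show ?thesis using pq beforeI[of p q s] by (simp add: nth_append)
  next
    case 2
    then show ?thesis using pq by (auto simp: nth_append)
  next
    case 3
    have "(x, y) \<in> before t"
      using 3 pq beforeI[of "p - length s" "q - length s" t] by (simp add: nth_append)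
    then show ?thesis by blast
  qed
next
  assume "(x, y) \<in> before s \<or> (x, y) \<in> before t \<or> x \<in> set s \<and> y \<in> set t"
  then consider (s) p q where "p < q" "q < length s" "x = s ! p" "y = s ! q"
    | (t) p q where "p < q" "q < length t" "x = t ! p" "y = t ! q"
    | (st) p q where "p < length s" "q < length t" "x = s ! p" "y = t ! q"
    unfolding before_def in_set_conv_nth by blast
  then show "(x, y) \<in> before (s @ t)"
  proof cases
    case s
    then show ?thesis using beforeI[of p q "s @ t"] by (simp add: nth_append)
  next
    case t
    then show ?thesis using beforeI[of "length s + p" "length s + q" "s @ t"] by simp
  next
    case st
    then show ?thesis using beforeI[of p "length s + q" "s @ t"] by (simp add: nth_append)
  qed
qed

lemma before_Cons: "(x, y) \<in> before (a # s) \<longleftrightarrow> x = a \<and> y \<in> set s \<or> (x, y) \<in> before s"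
proof -
  have "(x, y) \<notin> before [a]" unfolding before_def by auto
  then show ?thesis using before_append[of x y "[a]" s] by auto
qed

lemma linear_order_on_before:
  assumes "distinct s"
  shows "linear_order_on (set s) (before s \<union> Id_on (set s))"
  unfolding linear_order_on_def partial_order_on_def preorder_on_def
proof (intro conjI)
  show "before s \<union> Id_on (set s) \<subseteq> set s \<times> set s" "refl_on (set s) (before s \<union> Id_on (set s))"
    using before_subset by (fastforce simp: refl_on_def)+
  show "trans (before s \<union> Id_on (set s))"
    using before_trans[OF assms] by (intro transI) blast
  show "antisym (before s \<union> Id_on (set s))"
    using before_asym[OF assms] by (intro antisymI) blast
  show "total_on (set s) (before s \<union> Id_on (set s))"
    using before_total by (fastforce simp: total_on_def)
qed

text \<open>Sorting by rank lists the elements in increasing order. An inclusion suffices, since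
  enlarging the relation on letters only enlarges \<open>lexord\<close>.\<close>

lemma linear_order_on_imp_list:
  assumes "finite A" "linear_order_on A r"
  shows "\<exists>s \<in> permutations_of_set A. r - Id \<subseteq> before s"
proof -
  obtain xs where xs: "set xs = A" "distinct xs" using finite_distinct_list[OF assms(1)] by blast
  \<comment> \<open>The rank of \<open>x\<close>, counting \<open>x\<close> itself; it grows
    strictly along \<open>r - Id\<close>.\<close>
  define f where "f x = card {y. (y, x) \<in> r}" for x
  have r: "r \<subseteq> A \<times> A" "antisym r" "trans r" "refl_on A r"
    using assms(2) unfolding linear_order_on_def partial_order_on_def preorder_on_def by auto
  have fless: "f x < f y" if "(x, y) \<in> r - Id" for x y
    unfolding f_def
  proof (rule psubset_card_mono)
    show "finite {z. (z, y) \<in> r}" using r(1) by (intro finite_subset[OF _ assms(1)]) auto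
    have "(y, y) \<in> r" using r(1,4) that unfolding refl_on_def by auto
    moreover have "(y, x) \<notin> r" using that r(2) unfolding antisym_def by auto
    moreover have "{z. (z, x) \<in> r} \<subseteq> {z. (z, y) \<in> r}" using that r(3) unfolding trans_def by blast
    ultimately show "{z. (z, x) \<in> r} \<subset> {z. (z, y) \<in> r}" by blast
  qed
  define s where "s = sort_key f xs"
  have s: "set s = A" "distinct s" "sorted (map f s)" unfolding s_def using xs by auto
  have "(x, y) \<in> before s" if xy: "(x, y) \<in> r - Id" for x y
  proof -
    have "x \<in> set s" "y \<in> set s" using xy r(1) s by auto
    then obtain p q where pq: "p < length s" "q < length s" "x = s ! p" "y = s ! q"
      unfolding in_set_conv_nth by auto
    have "p < q"
    proof (rule ccontr)
      assume "\<not> p < q"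
      then have "f y \<le> f x" using s(3) pq by (auto simp: sorted_iff_nth_mono)
      then show False using fless[OF xy] by simp
    qed
    then show ?thesis unfolding before_def using pq by blast
  qed
  then have "r - Id \<subseteq> before s" by (rule subrelI)
  then show ?thesis using s unfolding permutations_of_set_def by blast
qed

text \<open>\<open>remdups\<close> keeps the last copy of each letter, so the double reversal keeps
  the first.\<close>

definition first_occs :: "'a list \<Rightarrow> 'a list" where
  "first_occs u = rev (remdups (rev u))"

lemma first_occs_Nil [simp]: "first_occs [] = []"
  and first_occs_snoc [simp]:
    "first_occs (u @ [c]) = (if c \<in> set u then first_occs u else first_occs u @ [c])"
  and set_first_occs [simp]: "set (first_occs u) = set u"
  and distinct_first_occs [simp]: "distinct (first_occs u)"
  by (auto simp: first_occs_def)

lemma length_first_occs [simp]: "length (first_occs u) = card (set u)"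
  using distinct_card[of "first_occs u"] by simp

lemma first_occs_append: "\<exists>s. first_occs (u @ v) = first_occs u @ s"
proof (induction v rule: rev_induct)
  case (snoc c v)
  then show ?case using first_occs_snoc[of "u @ v" c] by auto
qed simp

text \<open>Such a permutation is \<open>s\<close> followed by an arrangement of the letters outside
  \<open>s\<close>. This is the source of the factorial in the counts.\<close>

lemma card_permutations_with_prefix:
  assumes "finite A" "distinct s" "set s \<subseteq> A"
  shows "card {t \<in> permutations_of_set A. prefix s t} = fact (card A - length s)"
proof -
  have "{t \<in> permutations_of_set A. prefix s t} = (@) s ` permutations_of_set (A - set s)"
    using assms by (fastforce simp: permutations_of_set_def prefix_def image_iff)
  moreover have "inj_on ((@) s) (permutations_of_set (A - set s))" by (auto simp: inj_on_def)
  ultimately show ?thesis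
    using assms by (simp add: card_image card_Diff_subset distinct_card)
qed

section \<open>Conjugates and cyclic factors\<close>

text \<open>Rotating by \<open>length x\<close> further places brings \<open>u\<close> to the
  front.\<close>

lemma rotate_drop:
  assumes "i < length w" "prefix (x @ u) (rotate i w)" "u \<noteq> []"
  shows "\<exists>j < length w. prefix u (rotate j w)"
proof -
  obtain z where z: "rotate i w = x @ u @ z" using assms(2) by (auto simp: prefix_def)
  have "rotate (length x + i) w = rotate (length x) (x @ u @ z)"
    by (simp add: rotate_rotate[symmetric] z)
  also have "\<dots> = u @ z @ x" using rotate_append[of x "u @ z"] by simp
  finally have "prefix u (rotate ((length x + i) mod length w) w)"
    by (simp add: rotate_conv_mod[symmetric])
  moreover have "0 < length w" using assms(1) by linarith
  ultimately show ?thesis by (meson mod_less_divisor)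
qed

lemma letter_rotate:
  assumes "d \<in> set w"
  shows "\<exists>j < length w. prefix [d] (rotate j w)"
proof -
  obtain x z where "w = x @ d # z" using assms by (auto dest: split_list)
  then show ?thesis using rotate_drop[of 0 w x "[d]"] by auto
qed

lemma prefix_snoc_exists:
  assumes "prefix u v" "length u < length v"
  shows "\<exists>e. prefix (u @ [e]) v"
proof -
  obtain z where z: "v = u @ z" "z \<noteq> []" using assms by (auto simp: prefix_def)
  then obtain e z' where "z = e # z'" by (cases z) auto
  then show ?thesis using z by auto
qed

text \<open>An occurrence in \<open>w @ w\<close> at position \<open>length x\<close> starts the
  conjugate with index \<open>length x mod length w\<close>; as \<open>u\<close> is no longer than
  \<open>w\<close>, it fits inside that conjugate.\<close>

lemma cyclic_factor_iff:
  "cyclic_factor u w \<longleftrightarrow> u \<noteq> [] \<and> (\<exists>i < length w. prefix u (rotate i w))"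
proof
  assume "cyclic_factor u w"
  then obtain x z where u: "u \<noteq> []" "length u \<le> length w" "w @ w = x @ u @ z"
    unfolding cyclic_factor_def sublist_def by auto
  have w: "w \<noteq> []" using u by auto
  define i where "i = length x mod length w"
  have "prefix u (rotate i w)"
  proof (cases "length x < length w")
    case True
    have "drop (length x) (w @ w) = drop (length x) w @ w" using True by simp
    then have "u @ z = drop (length x) w @ w" using u(3) by simp
    moreover have "rotate i w = drop (length x) w @ take (length x) w"
      using True by (simp add: i_def rotate_drop_take)
    moreover have "drop (length x) w @ w
        = (drop (length x) w @ take (length x) w) @ drop (length x) w" by simp
    ultimately have "u @ z = rotate i w @ drop (length x) w" by metis
    then have "prefix u (rotate i w @ drop (length x) w)" by (metis prefixI)
    then show ?thesis using u(2) by (auto intro: prefix_length_prefix)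
  next
    \<comment> \<open>The occurrence lies wholly in the second copy of \<open>w\<close>.\<close>
    case False
    have "length w + length w = length x + length u + length z"
      using arg_cong[OF u(3), of length] by simp
    moreover have "0 < length u" "0 < length w" using u(1) w by simp_all
    ultimately have x: "length x - length w < length w" by linarith
    then have i: "i = length x - length w"
      using False by (simp add: i_def le_mod_geq)
    have "u @ z = drop (length x) (w @ w)" using u(3) by simp
    also have "\<dots> = drop i w" using False i by simp
    finally have "rotate i w = u @ z @ take i w" using x i by (simp add: rotate_drop_take)
    then show ?thesis by simp
  qed
  moreover have "i < length w" using w by (simp add: i_def)
  ultimately show "u \<noteq> [] \<and> (\<exists>i < length w. prefix u (rotate i w))" using u by blast
next
  assume "u \<noteq> [] \<and> (\<exists>i < length w. prefix u (rotate i w))"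
  then obtain i where i: "u \<noteq> []" "i < length w" "prefix u (rotate i w)" by blast
  have "w @ w = take i w @ rotate i w @ drop i w"
    using i by (simp add: rotate_drop_take)
  then have "sublist (rotate i w) (w @ w)" by (metis sublist_appendI)
  then have "sublist u (w @ w)" using i(3) sublist_order.order_trans prefix_imp_sublist by blast
  moreover have "length u \<le> length w" using prefix_length_le[OF i(3)] by simp
  ultimately show "cyclic_factor u w" using i by (simp add: cyclic_factor_def)
qed

text \<open>Proper conjugates are matched with other positions, not with other words, so that the
  Lyndon conditions become comparisons between positions.\<close>

lemma proper_conjugates_rotate:
  assumes "i < length w"
  shows "proper_conjugates (rotate i w) \<subseteq> {rotate j w | j. j < length w \<and> j \<noteq> i}"
    and "{rotate j w | j. j < length w \<and> j \<noteq> i} \<subseteq> proper_conjugates (rotate i w)"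
proof -
  show "proper_conjugates (rotate i w) \<subseteq> {rotate j w | j. j < length w \<and> j \<noteq> i}"
  proof
    fix v assume "v \<in> proper_conjugates (rotate i w)"
    then obtain x y where xy: "v = y @ x" "rotate i w = x @ y" "x \<noteq> []" "y \<noteq> []"
      unfolding proper_conjugates_def by auto
    have "length (rotate i w) = length (x @ y)" by (simp only: xy(2))
    then have lw: "length w = length x + length y" by simp
    define j where "j = (length x + i) mod length w"
    have "rotate (length x + i) w = v"
      by (simp add: rotate_rotate[symmetric] xy rotate_append)
    then have "rotate j w = v" by (simp add: j_def rotate_conv_mod[symmetric])
    moreover have "j < length w" unfolding j_def using assms by (intro mod_less_divisor) linarith
    moreover have "j \<noteq> i"
    proof -
      \<comment> \<open>A shift strictly between 0 and \<open>length w\<close> changes the position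
        modulo \<open>length w\<close>.\<close>
      have x: "0 < length x" "length x < length w" using lw xy by simp_all
      show ?thesis
      proof (cases "length x + i < length w")
        case True
        then show ?thesis using x by (simp add: j_def)
      next
        case False
        then have "j = (length x + i - length w) mod length w" by (simp add: j_def le_mod_geq)
        also have "\<dots> = length x + i - length w" using x assms by (intro mod_less) linarith
        finally show ?thesis using False x by linarith
      qed
    qed
    ultimately show "v \<in> {rotate j w | j. j < length w \<and> j \<noteq> i}" by blast
  qed
  show "{rotate j w | j. j < length w \<and> j \<noteq> i} \<subseteq> proper_conjugates (rotate i w)"
  proof
    fix v assume "v \<in> {rotate j w | j. j < length w \<and> j \<noteq> i}"
    then obtain j where j: "v = rotate j w" "j < length w" "j \<noteq> i" by blast
    \<comment> \<open>The cyclic distance from \<open>i\<close> to \<open>j\<close>.\<close>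
    define k where "k = (if i < j then j - i else length w + j - i)"
    have k: "0 < k" "k < length w" using j assms by (auto simp: k_def)
    have "rotate k (rotate i w) = v"
      using j assms rotate_conv_mod[of "length w + j" w]
      by (auto simp: rotate_rotate k_def rotate_conv_mod[symmetric])
    then have "v = drop k (rotate i w) @ take k (rotate i w)"
      using k by (simp add: rotate_drop_take)
    moreover have "rotate i w = take k (rotate i w) @ drop k (rotate i w)"
      "take k (rotate i w) \<noteq> []" "drop k (rotate i w) \<noteq> []"
      using k by auto
    ultimately show "v \<in> proper_conjugates (rotate i w)"
      unfolding proper_conjugates_def by blast
  qed
qed

text \<open>Equal lengths rule out a proper prefix, so only a comparison of letters after a common
  prefix remains.\<close>

lemma lexord_branch:
  assumes "(v, v') \<in> lexord r" "length v = length v'"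
  obtains u a b where "(a, b) \<in> r" "prefix (u @ [a]) v" "prefix (u @ [b]) v'"
proof -
  have "(\<exists>a x. v' = v @ a # x) \<or>
      (\<exists>u a b x y. (a, b) \<in> r \<and> v = u @ a # x \<and> v' = u @ b # y)"
    using assms(1) unfolding lexord_def by simp
  moreover have "v' \<noteq> v @ a # x" for a x using assms(2) by auto
  ultimately obtain u a b x y where "(a, b) \<in> r" "v = u @ a # x" "v' = u @ b # y" by blast
  then show thesis by (intro that[of a b u]) auto
qed

text \<open>Irreflexivity allows the common prefix \<open>u\<close> to be cancelled.\<close>

lemma lexord_branchD:
  assumes "(v, v') \<in> lexord r" "irrefl r" "prefix (u @ [a]) v" "prefix (u @ [b]) v'" "a \<noteq> b"
  shows "(a, b) \<in> r"
proof -
  obtain x y where "v = u @ a # x" "v' = u @ b # y" using assms(3,4) by (auto simp: prefix_def)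
  then show ?thesis using assms by (auto simp: lexord_same_pref_iff irrefl_def)
qed

section \<open>Occurrences in a universal Lyndon word\<close>

text \<open>One order per position is chosen once and for all. \<open>lex\<close> ranges over
  distinct positions, hence it also makes the conjugates pairwise different.\<close>

locale lyndon_orders =
  fixes w :: "'a list" and A :: "'a set" and ord :: "nat \<Rightarrow> 'a list"
  assumes finite_A: "finite A"
    and w_subset: "set w \<subseteq> A"
    and length_w: "length w = fact (card A)"
    and ord_perm: "i < length w \<Longrightarrow> ord i \<in> permutations_of_set A"
    and lex: "i < length w \<Longrightarrow> j < length w \<Longrightarrow> i \<noteq> j \<Longrightarrow>
      (rotate i w, rotate j w) \<in> lexord (before (ord i))"
begin

text \<open>Unlike \<open>cyclic_factor\<close>, this admits the empty word, where the induction on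
  factors starts.\<close>

definition occurs :: "'a list \<Rightarrow> bool" where
  "occurs u \<longleftrightarrow> (\<exists>i < length w. prefix u (rotate i w))"

lemma occursI: "i < length w \<Longrightarrow> prefix u (rotate i w) \<Longrightarrow> occurs u"
  unfolding occurs_def by blast

lemma occurs_prefix: "occurs (u @ v) \<Longrightarrow> occurs u"
  unfolding occurs_def by (meson append_prefixD)

lemma occurs_suffix: "occurs (x @ u) \<Longrightarrow> u \<noteq> [] \<Longrightarrow> occurs u"
  unfolding occurs_def using rotate_drop by metis

lemma occurs_subset: "occurs u \<Longrightarrow> set u \<subseteq> A"
  unfolding occurs_def using w_subset by (metis set_mono_prefix set_rotate subset_trans)

lemma distinct_ord: "i < length w \<Longrightarrow> distinct (ord i)"
  and set_ord: "i < length w \<Longrightarrow> set (ord i) = A"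
  using ord_perm by (auto simp: permutations_of_set_def)

text \<open>The conjugate at \<open>i\<close> is smaller for \<open>ord i\<close> than one starting
  with \<open>u @ [b]\<close>, and the two first differ in \<open>a\<close> against
  \<open>b\<close>.\<close>

lemma branch:
  assumes "i < length w" "prefix (u @ [a]) (rotate i w)" "occurs (u @ [b])" "a \<noteq> b"
  shows "(a, b) \<in> before (ord i)"
proof -
  obtain j where j: "j < length w" "prefix (u @ [b]) (rotate j w)"
    using assms(3) unfolding occurs_def by blast
  have "i \<noteq> j"
  proof
    assume "i = j"
    then have "prefix (u @ [b]) (rotate i w)" using j by simp
    then show False using assms(2,4) by (auto simp: prefix_def)
  qed
  then have "(rotate i w, rotate j w) \<in> lexord (before (ord i))" using lex assms(1) j by blast
  then show ?thesis
    using lexord_branchD assms j before_irrefl[OF distinct_ord[OF assms(1)]]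
    unfolding irrefl_def by metis
qed

lemma unique_repetition:
  assumes "occurs (u @ [c])" "occurs (u @ [d])" "c \<in> set u"
  shows "d = c"
proof (rule ccontr)
  assume "d \<noteq> c"
  obtain x t where u: "u = x @ c # t" using assms(3) by (auto dest: split_list)
  have ctc: "occurs ((c # t) @ [c])" and ctd: "occurs ((c # t) @ [d])"
    using assms(1,2) occurs_suffix[of x] by (auto simp: u)
  have d: "occurs [d]" using occurs_suffix assms(2) by blast
  obtain i where i: "i < length w" "prefix ((c # t) @ [d]) (rotate i w)"
    using ctd unfolding occurs_def by blast
  have "(d, c) \<in> before (ord i)" using branch[OF i ctc \<open>d \<noteq> c\<close>] .
  \<comment> \<open>Branching at the empty prefix: the first letter of a conjugate precedes every
    other occurring letter in its order.\<close>
  moreover have "prefix ([] @ [c]) (rotate i w)" using i(2) by (auto simp: prefix_def)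
  then have "(c, d) \<in> before (ord i)" using branch[of i "[]" c d] i(1) d \<open>d \<noteq> c\<close> by auto
  ultimately show False using before_asym distinct_ord i(1) by metis
qed

text \<open>Positions sharing an order would carry conjugates each smaller than the other.
  Injectivity is enough because both sets have \<open>fact (card A)\<close> elements.\<close>

lemma bij_betw_ord: "bij_betw ord {..<length w} (permutations_of_set A)"
proof -
  have inj: "inj_on ord {..<length w}"
  proof (rule inj_onI, rule ccontr)
    fix i j assume ij: "i \<in> {..<length w}" "j \<in> {..<length w}" "ord i = ord j" "i \<noteq> j"
    then have l: "(rotate i w, rotate j w) \<in> lexord (before (ord i))"
      "(rotate j w, rotate i w) \<in> lexord (before (ord i))"
      using lex[of i j] lex[of j i] by auto
    have "asym (before (ord i))"
      using before_asym distinct_ord ij by (metis asymI lessThan_iff)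
    then show False using l lexord_asymmetric by blast
  qed
  have "ord ` {..<length w} = permutations_of_set A"
  proof (rule card_subset_eq)
    show "finite (permutations_of_set A)" by simp
    show "ord ` {..<length w} \<subseteq> permutations_of_set A" using ord_perm by auto
    show "card (ord ` {..<length w}) = card (permutations_of_set A)"
      using finite_A by (subst card_image[OF inj]) (simp add: length_w)
  qed
  then show ?thesis using inj by (simp add: bij_betw_def)
qed

section \<open>Continuation of factors by new letters\<close>

lemma ord_surj:
  assumes "distinct s" "set s = A"
  shows "\<exists>i < length w. ord i = s"
proof -
  have "s \<in> ord ` {..<length w}"
    using bij_betw_ord assms by (auto simp: bij_betw_def permutations_of_set_def)
  then show ?thesis by auto
qed

text \<open>\<open>IH\<close> is the induction hypothesis of \<open>prefix_rotate_iff\<close>, with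
  \<open>s\<close> in the role of \<open>first_occs u\<close>. A next letter \<open>e\<close> other
  than \<open>c\<close> would precede \<open>c\<close> in \<open>ord i\<close>, hence lie in
  \<open>u\<close>, and would then be the only continuation of \<open>u\<close>.\<close>

lemma prefix_snoc_ordI:
  assumes IH: "\<And>i. i < length w \<Longrightarrow> prefix u (rotate i w) \<longleftrightarrow> prefix s (ord i)"
    and s: "set s = set u" and c: "occurs (u @ [c])" "c \<notin> set u"
    and i: "i < length w" "ord i = s @ c # t"
  shows "prefix (u @ [c]) (rotate i w)"
proof -
  have "prefix u (rotate i w)" using IH i by auto
  moreover have "length u < length w"
    using c(1) unfolding occurs_def by (auto dest: prefix_length_le)
  ultimately obtain e where e: "prefix (u @ [e]) (rotate i w)"
    using prefix_snoc_exists[of u "rotate i w"] by auto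
  have "e = c"
  proof (rule ccontr)
    assume "e \<noteq> c"
    then have "(e, c) \<in> before (s @ c # t)" using branch[OF i(1) e c(1)] i(2) by simp
    moreover have "distinct (s @ c # t)" using distinct_ord[OF i(1)] i(2) by simp
    ultimately have "e \<in> set s"
      by (auto simp: before_append before_Cons dest: before_subset)
    then have "e \<in> set u" using s by simp
    then show False using unique_repetition[OF occursI[OF i(1) e] c(1)] c(2) by simp
  qed
  then show ?thesis using e by simp
qed

lemma all_continuations:
  assumes IH: "\<And>i. i < length w \<Longrightarrow> prefix u (rotate i w) \<longleftrightarrow> prefix s (ord i)"
    and s: "distinct s" "set s = set u" and c: "occurs (u @ [c])" "c \<notin> set u"
    and d: "d \<in> A" "d \<notin> set u"
  shows "occurs (u @ [d])"
proof (rule ccontr)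
  assume no: "\<not> occurs (u @ [d])"
  then have "c \<noteq> d" using c by auto
  have cA: "c \<in> A" "set u \<subseteq> A" using occurs_subset[OF c(1)] by auto
  obtain t where t: "set t = A - set u - {c, d}" "distinct t"
    using finite_distinct_list finite_A by (metis finite_Diff)
  \<comment> \<open>Two orders that disagree only on the pair \<open>c\<close>,
    \<open>d\<close>.\<close>
  obtain i where i: "i < length w" "ord i = s @ c # d # t"
    using ord_surj[of "s @ c # d # t"] t s c d cA \<open>c \<noteq> d\<close> by auto
  obtain j where j: "j < length w" "ord j = s @ d # c # t"
    using ord_surj[of "s @ d # c # t"] t s c d cA \<open>c \<noteq> d\<close> by auto
  have ci: "prefix (u @ [c]) (rotate i w)"
    using prefix_snoc_ordI[OF IH s(2) c i] .
  have "prefix u (rotate j w)" using IH j by auto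
  moreover have "length u < length w"
    using c(1) unfolding occurs_def by (auto dest: prefix_length_le)
  ultimately obtain e where e: "prefix (u @ [e]) (rotate j w)"
    using prefix_snoc_exists[of u "rotate j w"] by auto
  \<comment> \<open>Although \<open>d\<close> precedes \<open>c\<close> in \<open>ord j\<close>, it
    cannot follow \<open>u\<close>, so \<open>c\<close> is again forced.\<close>
  have cj: "prefix (u @ [c]) (rotate j w)"
  proof (cases "e = c")
    case False
    have "(e, c) \<in> before (s @ d # c # t)" using branch[OF j(1) e c(1) False] j(2) by simp
    moreover have "distinct (s @ d # c # t)" using distinct_ord[OF j(1)] j(2) by simp
    ultimately have "e \<in> set s \<or> e = d"
      by (auto simp: before_append before_Cons dest: before_subset)
    moreover have "e \<noteq> d" using no occursI[OF j(1) e] by auto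
    ultimately have "e \<in> set u" using s by simp
    then show ?thesis using unique_repetition[OF occursI[OF j(1) e] c(1)] c(2) by simp
  qed (use e in simp)
  have "i \<noteq> j" using i j \<open>c \<noteq> d\<close> by auto
  then obtain v a b where v: "prefix (v @ [a]) (rotate i w)" "prefix (v @ [b]) (rotate j w)"
    and ab: "(a, b) \<in> before (ord i)"
    using lex[OF i(1) j(1)] by (auto elim: lexord_branch)
  have "a \<noteq> b" using ab before_irrefl distinct_ord i(1) by metis
  have ba: "(b, a) \<in> before (ord j)"
    using branch[OF j(1) v(2) occursI[OF i(1) v(1)]] \<open>a \<noteq> b\<close> by simp
  have "(a, b) \<notin> before (ord j)" using before_asym distinct_ord j(1) ba by metis
  \<comment> \<open>\<open>a\<close> precedes \<open>b\<close> in \<open>ord i\<close> but not in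
    \<open>ord j\<close>, which leaves only the swapped pair.\<close>
  then have cd: "a = c" "b = d"
    using ab i(2) j(2) by (auto simp: before_append before_Cons)
  \<comment> \<open>Both conjugates start with \<open>u @ [c]\<close>, so they can differ only
    beyond it.\<close>
  have "c \<in> set v"
  proof -
    have "length u < length v"
    proof (rule ccontr)
      assume "\<not> length u < length v"
      then have "prefix (v @ [a]) (u @ [c])" "prefix (v @ [b]) (u @ [c])"
        using prefix_length_prefix[OF v(1) ci] prefix_length_prefix[OF v(2) cj] by simp_all
      then show False using \<open>a \<noteq> b\<close> by (auto simp: prefix_def)
    qed
    then have "prefix (u @ [c]) v"
      using ci append_prefixD[OF v(1)] by (auto intro: prefix_length_prefix)
    then show ?thesis by (auto simp: prefix_def)
  qed
  then show False
    using unique_repetition[of v c d] v occursI i(1) j(1) cd \<open>c \<noteq> d\<close> by metis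
qed

lemma prefix_rotate_iff:
  assumes "occurs u" "i < length w"
  shows "prefix u (rotate i w) \<longleftrightarrow> prefix (first_occs u) (ord i)"
  using assms
proof (induction u arbitrary: i rule: rev_induct)
  case Nil
  then show ?case by simp
next
  case (snoc c u)
  have IH: "prefix u (rotate i w) \<longleftrightarrow> prefix (first_occs u) (ord i)" if "i < length w" for i
    using snoc occurs_prefix that by blast
  have len: "length u < length w"
    using snoc(2) unfolding occurs_def by (auto dest: prefix_length_le)
  show ?case
  proof (cases "c \<in> set u")
    case True
    \<comment> \<open>A repeated letter leaves \<open>first_occs\<close> unchanged and is a forced
      continuation.\<close>
    have "prefix (u @ [c]) (rotate i w)" if pre: "prefix u (rotate i w)"
    proof -
      obtain e where e: "prefix (u @ [e]) (rotate i w)"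
        using prefix_snoc_exists[of u "rotate i w"] pre len by auto
      then show ?thesis
        using unique_repetition[OF snoc(2) occursI[OF snoc(3) e] True] by simp
    qed
    then show ?thesis using IH[OF snoc(3)] True by (auto dest: append_prefixD)
  next
    case False
    show ?thesis
    proof
      assume c: "prefix (u @ [c]) (rotate i w)"
      then have "prefix (first_occs u) (ord i)" using IH snoc(3) by (auto dest: append_prefixD)
      then obtain t where t: "ord i = first_occs u @ t" by (auto simp: prefix_def)
      have "c \<in> set (ord i)" using set_ord[OF snoc(3)] occurs_subset[OF snoc(2)] by auto
      then have "c \<in> set t" using t False by simp
      \<comment> \<open>\<open>d\<close> is the letter that \<open>ord i\<close> puts right after
        those of \<open>u\<close>. It can continue \<open>u\<close> because \<open>c\<close> does,
        hence it follows \<open>u\<close> at \<open>i\<close>, and so equals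
        \<open>c\<close>.\<close>
      then obtain d t' where d: "t = d # t'" by (cases t) auto
      have "d \<notin> set u" "d \<in> A"
        using distinct_ord[OF snoc(3)] set_ord[OF snoc(3)] t d by auto
      then have "occurs (u @ [d])"
        using all_continuations[OF IH _ _ snoc(2) False] by simp
      then have "prefix (u @ [d]) (rotate i w)"
        using prefix_snoc_ordI[OF IH _ _ \<open>d \<notin> set u\<close> snoc(3)] t d by simp
      then have "d = c" using c by (auto simp: prefix_def)
      then show "prefix (first_occs (u @ [c])) (ord i)" using t d False by simp
    next
      assume "prefix (first_occs (u @ [c])) (ord i)"
      then obtain t where "ord i = first_occs u @ c # t" using False by (auto simp: prefix_def)
      then show "prefix (u @ [c]) (rotate i w)"
        using prefix_snoc_ordI[OF IH _ snoc(2) False snoc(3)] by simp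
    qed
  qed
qed

text \<open>The bijection \<open>ord\<close> carries the positions of \<open>u\<close> to the
  permutations with prefix \<open>first_occs u\<close>.\<close>

lemma cyclic_count_eq:
  assumes "cyclic_factor u w"
  shows "cyclic_count w u = fact (card A - card (set u))"
proof -
  have occ: "occurs u" using assms unfolding cyclic_factor_iff occurs_def by blast
  let ?I = "{i. i < length w \<and> prefix u (rotate i w)}"
  let ?P = "{t \<in> permutations_of_set A. prefix (first_occs u) t}"
  have I: "?I = {i \<in> {..<length w}. prefix (first_occs u) (ord i)}"
    using prefix_rotate_iff[OF occ] by auto
  have "permutations_of_set A = ord ` {..<length w}"
    using bij_betw_ord by (simp add: bij_betw_def)
  then have "?P = {t \<in> ord ` {..<length w}. prefix (first_occs u) t}" by (simp only:)
  also have "\<dots> = ord ` ?I" unfolding I by auto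
  finally have "ord ` ?I = ?P" ..
  moreover have "inj_on ord ?I"
    by (rule inj_on_subset[OF bij_betw_imp_inj_on[OF bij_betw_ord]]) auto
  then have "card (ord ` ?I) = card ?I" by (rule card_image)
  ultimately have "card ?I = card ?P" by (simp only:)
  then show ?thesis
    using card_permutations_with_prefix[OF finite_A, of "first_occs u"] occurs_subset[OF occ]
    by (simp add: cyclic_count_def)
qed

text \<open>Some letter continues the empty word, hence every letter of \<open>A\<close>
  does.\<close>

lemma set_w: "set w = A"
proof -
  have "d \<in> set w" if "d \<in> A" for d
  proof -
    have "w \<noteq> []" using length_w by auto
    then obtain c where "c \<in> set w" by (cases w) auto
    then have "occurs ([] @ [c])" using letter_rotate unfolding occurs_def by fastforce
    then have "occurs ([] @ [d])"
      using all_continuations[of "[]" "[]" c d] that by simp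
    then show ?thesis unfolding occurs_def by (auto dest: set_mono_prefix)
  qed
  then show ?thesis using w_subset by auto
qed

end

section \<open>Choice of an order for each conjugate\<close>

lemma universal_lyndon_orders:
  assumes "universal_lyndon n w"
  shows "\<exists>ord. lyndon_orders w (Sigma_n n) ord"
proof -
  have "\<exists>s. s \<in> permutations_of_set (Sigma_n n) \<and>
      (\<forall>j < length w. i \<noteq> j \<longrightarrow> (rotate i w, rotate j w) \<in> lexord (before s))"
    if i: "i < length w" for i
  proof -
    obtain r where r: "linear_order_on (Sigma_n n) r"
      "\<forall>v \<in> proper_conjugates (rotate i w). (rotate i w, v) \<in> lexord (r - Id)"
      using assms i unfolding universal_lyndon_def lyndon_def by blast
    obtain s where s: "s \<in> permutations_of_set (Sigma_n n)" "r - Id \<subseteq> before s"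
      using linear_order_on_imp_list[OF _ r(1)] by auto
    have "(rotate i w, rotate j w) \<in> lexord (before s)" if "j < length w" "i \<noteq> j" for j
    proof -
      have "(rotate i w, rotate j w) \<in> lexord (r - Id)"
        using r(2) proper_conjugates_rotate(2)[OF i] that by blast
      then show ?thesis using s(2) unfolding lexord_def by blast
    qed
    then show ?thesis using s by blast
  qed
  then obtain ord where "\<And>i. i < length w \<Longrightarrow> ord i \<in> permutations_of_set (Sigma_n n) \<and>
      (\<forall>j < length w. i \<noteq> j \<longrightarrow> (rotate i w, rotate j w) \<in> lexord (before (ord i)))"
    by metis
  then have "lyndon_orders w (Sigma_n n) ord"
    using assms unfolding universal_lyndon_def by unfold_locales auto
  then show ?thesis by blast
qed

section \<open>Universal Lyndon words from the counts\<close>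

lemma cyclic_count_disjoint:
  assumes "\<And>i. i < length w \<Longrightarrow> prefix u (rotate i w) \<Longrightarrow> prefix v (rotate i w) \<Longrightarrow> False"
    and "\<And>i. i < length w \<Longrightarrow> prefix u (rotate i w) \<Longrightarrow> prefix z (rotate i w)"
    and "\<And>i. i < length w \<Longrightarrow> prefix v (rotate i w) \<Longrightarrow> prefix z (rotate i w)"
  shows "cyclic_count w u + cyclic_count w v \<le> cyclic_count w z"
proof -
  have "cyclic_count w u + cyclic_count w v = card ({i. i < length w \<and> prefix u (rotate i w)} \<union>
      {i. i < length w \<and> prefix v (rotate i w)})"
    unfolding cyclic_count_def using assms(1) by (subst card_Un_disjoint) auto
  also have "\<dots> \<le> cyclic_count w z"
    unfolding cyclic_count_def using assms(2,3) by (intro card_mono) auto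
  finally show ?thesis .
qed

text \<open>If \<open>c\<close> were in \<open>u\<close>, then \<open>u\<close> and
  \<open>u @ [c]\<close> would have the same letters and hence equal counts, leaving no position for
  \<open>u @ [d]\<close>, whose count is a factorial and thus positive.\<close>

lemma branch_new_letter:
  assumes count: "\<And>u. cyclic_factor u w \<Longrightarrow> cyclic_count w u = fact (n - card (set u))"
    and i: "i < length w" "prefix (u @ [c]) (rotate i w)"
    and j: "j < length w" "prefix (u @ [d]) (rotate j w)"
    and "c \<noteq> d"
  shows "c \<notin> set u"
proof
  assume c: "c \<in> set u"
  then have "u \<noteq> []" by auto
  then have "cyclic_factor u w" "cyclic_factor (u @ [c]) w" "cyclic_factor (u @ [d]) w"
    using i j append_prefixD unfolding cyclic_factor_iff by blast+
  note cnt = this[THEN count]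
  have "cyclic_count w (u @ [c]) + cyclic_count w (u @ [d]) \<le> cyclic_count w u"
    using \<open>c \<noteq> d\<close> by (intro cyclic_count_disjoint) (auto simp: prefix_def)
  then show False using c cnt by (simp add: insert_absorb)
qed

text \<open>Each position is counted once, under the first letter of its conjugate. This recovers
  the length of \<open>w\<close> from the counts of single letters.\<close>

lemma sum_cyclic_count_letters:
  "(\<Sum>c \<in> set w. cyclic_count w [c]) = length w"
proof -
  have 1: "\<exists>!c. c \<in> set w \<and> prefix [c] (rotate i w)" if i: "i < length w" for i
  proof -
    obtain c z where "rotate i w = c # z" using i by (cases "rotate i w") auto
    moreover from this have "c \<in> set w" by (metis list.set_intros(1) set_rotate)
    ultimately show ?thesis by auto
  qed
  have "(\<Sum>c \<in> set w. cyclic_count w [c])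
      = card (\<Union>c \<in> set w. {i. i < length w \<and> prefix [c] (rotate i w)})"
    unfolding cyclic_count_def using 1 by (subst card_UN_disjoint) auto
  also have "(\<Union>c \<in> set w. {i. i < length w \<and> prefix [c] (rotate i w)}) = {..<length w}"
    using 1 by blast
  finally show ?thesis by simp
qed

lemma universal_lyndonI:
  assumes "n \<ge> 1" and w: "set w = Sigma_n n"
    and count: "\<And>u. cyclic_factor u w \<Longrightarrow> cyclic_count w u = fact (n - card (set u))"
  shows "universal_lyndon n w"
  unfolding universal_lyndon_def
proof (intro conjI allI impI)
  show "set w \<subseteq> Sigma_n n" using w by simp
  have "cyclic_count w [c] = fact (n - 1)" if "c \<in> set w" for c
    using count[of "[c]"] letter_rotate[OF that] by (simp add: cyclic_factor_iff)
  then have "length w = n * fact (n - 1)"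
    using sum_cyclic_count_letters[of w] w by simp
  then show "length w = fact n" using \<open>n \<ge> 1\<close> by (simp add: fact_reduce)
next
  fix i assume i: "i < length w"
  define s where "s = first_occs (rotate i w)"
  have s: "set s = Sigma_n n" "distinct s" using w by (auto simp: s_def)
  have lex: "(rotate i w, rotate j w) \<in> lexord (before s)" if j: "j < length w" "j \<noteq> i" for j
  proof -
    have "rotate i w \<noteq> rotate j w"
    proof
      assume "rotate i w = rotate j w"
      then have "{i, j} \<subseteq> {k. k < length w \<and> prefix (rotate i w) (rotate k w)}"
        using i j by auto
      then have "card {i, j} \<le> cyclic_count w (rotate i w)"
        unfolding cyclic_count_def by (intro card_mono) auto
      moreover have "cyclic_factor (rotate i w) w"
        unfolding cyclic_factor_iff using i by auto
      \<comment> \<open>The whole conjugate contains all \<open>n\<close> letters, so its count is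
        \<open>fact 0 = 1\<close>, yet \<open>i\<close> and \<open>j\<close> are two
        positions.\<close>
      ultimately show False using count[of "rotate i w"] w j by simp
    qed
    moreover have "\<not> strict_prefix x y" if "length x = length y" for x y :: "nat list"
      using that by (auto dest: prefix_length_less)
    ultimately have "rotate i w \<parallel> rotate j w"
      by (metis length_rotate parallelI strict_prefixI)
    then obtain u c x d y where cd: "c \<noteq> d" "rotate i w = u @ c # x" "rotate j w = u @ d # y"
      using parallel_decomp by blast
    then have pre: "prefix (u @ [c]) (rotate i w)" "prefix (u @ [d]) (rotate j w)" by auto
    have cu: "c \<notin> set u" using branch_new_letter[OF count i pre(1) j(1) pre(2) cd(1)] .
    have du: "d \<notin> set u" using branch_new_letter[OF count j(1) pre(2) i pre(1)] cd(1) by simp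
    obtain t where "s = first_occs (u @ [c]) @ t"
      using first_occs_append[of "u @ [c]" x] cd(2) by (auto simp: s_def)
    then have t: "s = first_occs u @ c # t" using cu by simp
    have "d \<in> set (rotate j w)" using cd(3) by simp
    then have "d \<in> set s" using w s by simp
    \<comment> \<open>\<open>d\<close> is neither \<open>c\<close> nor a letter of \<open>u\<close>,
      so it first occurs after \<open>c\<close>.\<close>
    then have "(c, d) \<in> before s" using t du cd(1) by (auto simp: before_append before_Cons)
    then show ?thesis unfolding cd(2,3) by (simp add: lexord_append_leftI)
  qed
  have diff: "before s \<union> Id_on (set s) - Id = before s"
    using before_irrefl[OF s(2)] by auto
  show "lyndon n (rotate i w)"
    unfolding lyndon_def
  proof (intro conjI exI ballI)
    show "set (rotate i w) \<subseteq> Sigma_n n" using w by simp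
    show "linear_order_on (Sigma_n n) (before s \<union> Id_on (set s))"
      using linear_order_on_before[OF s(2)] s(1) by simp
    fix v assume "v \<in> proper_conjugates (rotate i w)"
    then show "(rotate i w, v) \<in> lexord (before s \<union> Id_on (set s) - Id)"
      using proper_conjugates_rotate(1)[OF i] lex unfolding diff by blast
  qed
qed

text \<open>For \<open>n = 0\<close> the empty word satisfies the right-hand side, but its length is
  not \<open>fact 0 = 1\<close>; hence the bound on \<open>n\<close>.\<close>

theorem theorem2:
  fixes n :: nat and w :: "nat list"
  assumes "n \<ge> 1" and "set w \<subseteq> Sigma_n n"
  shows "universal_lyndon n w \<longleftrightarrow>
    set w = Sigma_n n \<and>
    (\<forall>u. cyclic_factor u w \<longrightarrow> cyclic_count w u = fact (n - card (set u)))"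
proof
  assume "universal_lyndon n w"
  then obtain ord where "lyndon_orders w (Sigma_n n) ord" using universal_lyndon_orders by blast
  then interpret lyndon_orders w "Sigma_n n" ord .
  show "set w = Sigma_n n \<and>
    (\<forall>u. cyclic_factor u w \<longrightarrow> cyclic_count w u = fact (n - card (set u)))"
    using set_w cyclic_count_eq by simp
next
  assume "set w = Sigma_n n \<and>
    (\<forall>u. cyclic_factor u w \<longrightarrow> cyclic_count w u = fact (n - card (set u)))"
  then show "universal_lyndon n w" using universal_lyndonI[OF assms(1)] by blast
qed

end
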